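(* Let $S$ be a semigroup. Then: (1) the relation $\sim_c$ is an equivalence relation on $S$; (2) for the relations $\sim_l$, $\sim_p$, $\sim_o$ and $\sim_c$ on $S$: (a) $\sim_c\,\subseteq\,\sim_o\,\subseteq\,\sim_l$; (b) if $S$ is a semigroup without zero, then $\sim_c\,=\,\sim_o$; and (c) if $S$ is a group or a free semigroup, then $\sim_c\,=\,\sim_l\,=\,\sim_p\,=\,\sim_o$.
   Context: For a semigroup $S$, $S^1$ denotes $S$ if $S$ is a monoid, and $S$ with an identity $1$ adjoined otherwise. Define relations on $S$ by: - $a\sim_l b$ iff there is $g\in S^1$ with $ag=gb$; - $a\sim_p b$ iff there are $u,v\in S^1$ with $a=uv$ and $b=vu$; - $a\sim_o b$ iff there are $g,h\in S^1$ with $ag=gb$ and $bh=ha$. If $S$ has a zero $0$ and $a\in S$, $a\neq 0$, let $\mathbb{P}(a)$ be the set of all $g\in S$ such that $(ma)g\neq 0$ for every $ma\in S^1a\setminus\{0\}$; put $\mathbb{P}(0)=\{0\}$. If $S$ has no zero, put $\mathbb{P}(a)=S$ for every $a\in S$. Let $\mathbb{P}^1(a)=\mathbb{P}(a)\cup\{1\}$, where $1$ is the identity of $S^1$. Define $$a\sim_c b\iff \exists g\in\mathbb{P}^1(a)\ \exists h\in\mathbb{P}^1(b):\ ag=gb\ \text{ and }\ bh=ha.$$ *)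

theory Defs
  imports Main
begin

text \<open>
  The semigroup \<open>S\<close> is a type \<open>'a\<close> of class \<open>semigroup_mult\<close>, ranging over all nonempty
  semigroups. \<open>monoid\<close> and \<open>group\<close> are the locales of \<open>HOL.Groups\<close>, so \<open>monoid (*) e\<close> says
  that \<open>e\<close> is a two-sided identity of \<open>S\<close>.

  Elements of \<open>S\<^sup>1\<close> are represented in \<open>'a option\<close>: \<open>Some a\<close> is the element \<open>a\<close> of \<open>S\<close>, and
  \<open>None\<close> is the adjoined identity. \<open>None\<close> belongs to \<open>S\<^sup>1\<close> only if \<open>S\<close> has no identity.
\<close>

definition S1 :: "'a::semigroup_mult option set" where
  "S1 = (if \<exists>e::'a. monoid (*) e then range Some else UNIV)"

definition one1 :: "'a::semigroup_mult option" where
  "one1 = (if \<exists>e::'a. monoid (*) e then Some (THE e. monoid (*) e) else None)"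

fun mult1 :: "'a::semigroup_mult option \<Rightarrow> 'a option \<Rightarrow> 'a option" (infixl \<open>\<cdot>\<close> 70) where
  "None \<cdot> y = y"
| "Some a \<cdot> None = Some a"
| "Some a \<cdot> Some b = Some (a * b)"

definition sim_l :: "'a::semigroup_mult rel" where
  "sim_l = {(a, b). \<exists>g\<in>S1. Some a \<cdot> g = g \<cdot> Some b}"

definition sim_p :: "'a::semigroup_mult rel" where
  "sim_p = {(a, b). \<exists>u\<in>S1. \<exists>v\<in>S1. Some a = u \<cdot> v \<and> Some b = v \<cdot> u}"

definition sim_o :: "'a::semigroup_mult rel" where
  "sim_o = {(a, b). \<exists>g\<in>S1. \<exists>h\<in>S1.
              Some a \<cdot> g = g \<cdot> Some b \<and> Some b \<cdot> h = h \<cdot> Some a}"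

definition is_zero :: "'a::semigroup_mult \<Rightarrow> bool" where
  "is_zero z \<longleftrightarrow> (\<forall>x. z * x = z \<and> x * z = z)"

definition left_ideal1 :: "'a::semigroup_mult \<Rightarrow> 'a set" where
  "left_ideal1 a = {x. \<exists>m\<in>S1. Some x = m \<cdot> Some a}"

text \<open>A semigroup has at most one zero, so \<open>is_zero x\<close> plays the role of \<open>x = 0\<close>.\<close>

definition PP :: "'a::semigroup_mult \<Rightarrow> 'a set" where
  "PP a = (if \<exists>z::'a. is_zero z
           then if is_zero a then {a}
                else {g. \<forall>x \<in> left_ideal1 a - {z. is_zero z}. \<not> is_zero (x * g)}
           else UNIV)"

definition PP1 :: "'a::semigroup_mult \<Rightarrow> 'a option set" where
  "PP1 a = Some ` PP a \<union> {one1}"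

definition sim_c :: "'a::semigroup_mult rel" where
  "sim_c = {(a, b). \<exists>g\<in>PP1 a. \<exists>h\<in>PP1 b.
              Some a \<cdot> g = g \<cdot> Some b \<and> Some b \<cdot> h = h \<cdot> Some a}"

text \<open>
  A free semigroup is one isomorphic to the semigroup of nonempty words over some alphabet \<open>A\<close>,
  under concatenation. The letters embed in \<open>S\<close> as one-letter words, so taking \<open>A\<close> to be a set
  of elements of type \<open>'a\<close> loses no generality.
\<close>

definition is_free_semigroup :: "'a::semigroup_mult itself \<Rightarrow> bool" where
  "is_free_semigroup _ \<longleftrightarrow>
     (\<exists>(A :: 'a set) (\<phi> :: 'a list \<Rightarrow> 'a).
        bij_betw \<phi> (lists A - {[]}) UNIV \<and>
        (\<forall>u \<in> lists A - {[]}. \<forall>v \<in> lists A - {[]}. \<phi> (u @ v) = \<phi> u * \<phi> v))"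

end

theory Submission
  imports Defs
begin

text \<open>
  If \<open>g\<close> is in \<open>\<P>\<^sup>1(a)\<close>, \<open>ag = gb\<close>, and \<open>ma \<noteq> 0\<close>, then \<open>(mg)b = (ma)g \<noteq> 0\<close>; so for \<open>g'\<close> in
  \<open>\<P>\<^sup>1(b)\<close> also \<open>(ma)gg' = (mg)bg' \<noteq> 0\<close>, that is, \<open>gg'\<close> is in \<open>\<P>\<^sup>1(a)\<close>. This makes \<open>\<sim>\<^sub>c\<close>
  transitive away from zero, and \<open>{0}\<close> is a class of its own. In a free semigroup, cancelling
  copies of \<open>a\<close> from the left of \<open>g\<close> in \<open>ag = gb\<close> leads to a \<open>g\<close> that is a prefix of \<open>a\<close>, so
  that \<open>a = gv\<close> and \<open>b = vg\<close>.
\<close>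

section \<open>Arithmetic in \<open>S1\<close>\<close>

lemma mult1_None_right [simp]: "x \<cdot> None = x"
  by (cases x) auto

lemma mult1_assoc: "x \<cdot> y \<cdot> z = x \<cdot> (y \<cdot> z)"
  by (cases x; cases y; cases z) (auto simp: mult.assoc)

lemma Some_in_S1 [simp]: "Some x \<in> S1"
  by (simp add: S1_def)

lemma mult1_in_S1: "x \<in> S1 \<Longrightarrow> y \<in> S1 \<Longrightarrow> x \<cdot> y \<in> S1"
  by (cases x; cases y) auto

lemma one1_eq:
  assumes "monoid (*) (e::'a::semigroup_mult)"
  shows "one1 = Some e"
proof -
  have "e' = e" if "monoid (*) e'" for e' :: 'a
    using assms that by (metis monoid.left_neutral monoid.right_neutral)
  with assms have "(THE e::'a. monoid (*) e) = e"
    by blast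
  with assms show ?thesis
    by (auto simp: one1_def)
qed

lemma one1_in_S1 [simp]: "one1 \<in> S1"
  by (auto simp: S1_def one1_def)

text \<open>\<open>None\<close> is neutral for the product on options even when \<open>S1\<close>
  omits it. If S has an identity e, then \<open>one1\<close> is \<open>Some e\<close>, which is
  neutral only against elements of S: \<open>one1 \<cdot> None\<close> is \<open>one1\<close>. Hence
  the restriction to \<open>Some a\<close>.\<close>

lemma mult1_one1_Some [simp]: "one1 \<cdot> Some (a::'a::semigroup_mult) = Some a"
  and mult1_Some_one1 [simp]: "Some a \<cdot> one1 = Some a"
proof -
  have "one1 \<cdot> Some a = Some a \<and> Some a \<cdot> one1 = Some a"
  proof (cases "\<exists>e::'a. monoid (*) e")
    case True
    then obtain e :: 'a where "monoid (*) e" ..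
    then show ?thesis
      by (simp add: one1_eq monoid.left_neutral monoid.right_neutral)
  qed (simp add: one1_def)
  then show "one1 \<cdot> Some a = Some a" "Some a \<cdot> one1 = Some a"
    by auto
qed

lemma None_in_S1D: "None \<in> (S1 :: 'a::semigroup_mult option set) \<Longrightarrow> (one1 :: 'a option) = None"
  by (auto simp: S1_def one1_def split: if_splits)

section \<open>Zeros and the sets \<open>PP1\<close>\<close>

definition zero1 :: "'a::semigroup_mult option \<Rightarrow> bool" where
  "zero1 x \<longleftrightarrow> (\<exists>z. is_zero z \<and> x = Some z)"

lemma zero1_Some [simp]: "zero1 (Some a) \<longleftrightarrow> is_zero a"
  by (simp add: zero1_def)

lemma zero1_mult_left: "is_zero a \<Longrightarrow> zero1 (x \<cdot> Some a)"
  by (cases x) (auto simp: is_zero_def)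

lemma is_zero_unique: "is_zero a \<Longrightarrow> is_zero b \<Longrightarrow> a = b"
  unfolding is_zero_def by metis

lemma PP1_subset_S1: "PP1 a \<subseteq> S1"
  by (auto simp: PP1_def)

lemma PP1_no_zero:
  assumes "\<not> (\<exists>z::'a::semigroup_mult. is_zero z)"
  shows "PP1 (a::'a) = S1"
proof
  show "S1 \<subseteq> PP1 a"
  proof
    fix g :: "'a option"
    assume "g \<in> S1"
    with assms show "g \<in> PP1 a"
      by (cases g) (auto simp: PP1_def PP_def dest: None_in_S1D)
  qed
qed (rule PP1_subset_S1)

text \<open>Quantifying over multipliers m instead of elements of the left ideal lets associativity
  move factors into m, and it treats \<open>one1\<close> like any other g. If S has no zero, the
  condition on m is vacuous.\<close>

lemma PP1_nonzero_iff:
  assumes "\<not> is_zero a"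
  shows "g \<in> PP1 a \<longleftrightarrow>
    g \<in> S1 \<and> (\<forall>m\<in>S1. \<not> zero1 (m \<cdot> Some a) \<longrightarrow> \<not> zero1 (m \<cdot> Some a \<cdot> g))"
proof -
  have one: "x \<cdot> Some a \<cdot> one1 = x \<cdot> Some a" for x
    by (simp add: mult1_assoc)
  have PP: "x \<in> PP a \<longleftrightarrow>
      (\<forall>m\<in>S1. \<not> zero1 (m \<cdot> Some a) \<longrightarrow> \<not> zero1 (m \<cdot> Some a \<cdot> Some x))" for x
  proof -
    have ideal: "(\<forall>y\<in>left_ideal1 a. \<not> is_zero y \<longrightarrow> \<not> is_zero (y * x)) \<longleftrightarrow>
        (\<forall>m\<in>S1. \<not> zero1 (m \<cdot> Some a) \<longrightarrow> \<not> zero1 (m \<cdot> Some a \<cdot> Some x))"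
      (is "?l \<longleftrightarrow> ?r")
    proof
      assume l: ?l
      show ?r
      proof
        fix m :: "'a option"
        assume m: "m \<in> S1"
        obtain y where "m \<cdot> Some a = Some y"
          by (cases m) auto
        with l m show "\<not> zero1 (m \<cdot> Some a) \<longrightarrow> \<not> zero1 (m \<cdot> Some a \<cdot> Some x)"
          by (force simp: left_ideal1_def)
      qed
    next
      assume r: ?r
      show ?l
      proof (intro ballI impI)
        fix y
        assume "y \<in> left_ideal1 a" "\<not> is_zero y"
        then obtain m where "m \<in> S1" "Some y = m \<cdot> Some a"
          by (auto simp: left_ideal1_def)
        with r \<open>\<not> is_zero y\<close> show "\<not> is_zero (y * x)"
          by (metis mult1.simps(3) zero1_Some)
      qed
    qed
    show ?thesis
    proof (cases "\<exists>z::'a. is_zero z")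
      case True
      with assms have "x \<in> PP a \<longleftrightarrow> (\<forall>y\<in>left_ideal1 a. \<not> is_zero y \<longrightarrow> \<not> is_zero (y * x))"
        by (auto simp: PP_def)
      with ideal show ?thesis
        by simp
    qed (simp add: PP_def zero1_def)
  qed
  show ?thesis
  proof (cases "g = one1")
    case True
    then show ?thesis
      by (simp add: PP1_def one)
  next
    case False
    then show ?thesis
      by (cases g) (auto simp: PP1_def PP dest: None_in_S1D)
  qed
qed

section \<open>The relation \<open>sim_c\<close> is an equivalence\<close>

lemma sim_cI:
  "g \<in> PP1 a \<Longrightarrow> h \<in> PP1 b \<Longrightarrow> Some a \<cdot> g = g \<cdot> Some b \<Longrightarrow> Some b \<cdot> h = h \<cdot> Some a
    \<Longrightarrow> (a, b) \<in> sim_c"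
  by (auto simp: sim_c_def)

lemma sim_cE:
  assumes "(a, b) \<in> sim_c"
  obtains g h where "g \<in> PP1 a" "h \<in> PP1 b" "Some a \<cdot> g = g \<cdot> Some b" "Some b \<cdot> h = h \<cdot> Some a"
  using assms by (auto simp: sim_c_def)

lemma sim_c_refl: "(a, a) \<in> sim_c"
  by (rule sim_cI[of one1 _ one1]) (auto simp: PP1_def)

lemma sim_c_sym: "(a, b) \<in> sim_c \<Longrightarrow> (b, a) \<in> sim_c"
  by (auto simp: sim_c_def)

text \<open>If b were nonzero, the multiplier m = 1 in the condition on h would give bh nonzero,
  whereas bh = ha is zero.\<close>

lemma sim_c_zeroD:
  assumes "(a, b) \<in> sim_c" "is_zero a"
  shows "b = a"
proof (cases "is_zero b")
  case True
  then show ?thesis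
    using assms(2) is_zero_unique by blast
next
  case False
  obtain h where h: "h \<in> PP1 b" "Some b \<cdot> h = h \<cdot> Some a"
    using assms(1) by (rule sim_cE)
  have "\<not> zero1 (one1 \<cdot> Some b \<cdot> h)"
    using h(1) False PP1_nonzero_iff[OF False, of h]
    by (metis mult1_one1_Some one1_in_S1 zero1_Some)
  with h(2) have False
    using zero1_mult_left[OF assms(2), of h] by simp
  then show ?thesis ..
qed

lemma PP1_mult:
  assumes "\<not> is_zero a" "\<not> is_zero b"
    and g: "g \<in> PP1 a" and g': "g' \<in> PP1 b" and eq: "Some a \<cdot> g = g \<cdot> Some b"
  shows "g \<cdot> g' \<in> PP1 a"
proof -
  have S: "g \<in> S1" "g' \<in> S1"
    using g g' PP1_subset_S1 by auto
  have "\<not> zero1 (m \<cdot> Some a \<cdot> (g \<cdot> g'))" if m: "m \<in> S1" "\<not> zero1 (m \<cdot> Some a)" for m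
  proof -
    have *: "m \<cdot> Some a \<cdot> g = m \<cdot> g \<cdot> Some b"
      by (simp add: eq mult1_assoc)
    have "\<not> zero1 (m \<cdot> Some a \<cdot> g)"
      using g m PP1_nonzero_iff[OF assms(1)] by blast
    \<comment> \<open>The condition on \<open>g'\<close> is applied to the multiplier
      \<open>m \<cdot> g\<close>, which is legitimate because \<open>*\<close> makes
      \<open>m \<cdot> g \<cdot> Some b\<close> nonzero.\<close>
    then have "\<not> zero1 (m \<cdot> g \<cdot> Some b \<cdot> g')"
      using g' mult1_in_S1[OF m(1) S(1)] PP1_nonzero_iff[OF assms(2)] * by metis
    with * show ?thesis
      by (metis mult1_assoc)
  qed
  with S show ?thesis
    by (simp add: PP1_nonzero_iff[OF assms(1)] mult1_in_S1)
qed

lemma mult1_intertwine: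
  assumes "a \<cdot> g = g \<cdot> b" "b \<cdot> g' = g' \<cdot> c"
  shows "a \<cdot> (g \<cdot> g') = g \<cdot> g' \<cdot> c"
proof -
  have "a \<cdot> (g \<cdot> g') = g \<cdot> b \<cdot> g'"
    by (simp add: assms(1) flip: mult1_assoc)
  also have "\<dots> = g \<cdot> g' \<cdot> c"
    by (simp add: assms(2) mult1_assoc)
  finally show ?thesis .
qed

lemma sim_c_trans:
  assumes ab: "(a, b) \<in> sim_c" and bc: "(b, c) \<in> sim_c"
  shows "(a, c) \<in> sim_c"
\<comment> \<open>\<open>PP1_mult\<close> is about nonzero elements. A zero among the three equals
  its neighbour by \<open>sim_c_zeroD\<close> and symmetry, so one of the two assumptions is already
  the claim.\<close>
proof (cases "is_zero a \<or> is_zero b \<or> is_zero c")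
  case True
  then show ?thesis
    using ab bc sim_c_zeroD sim_c_sym by metis
next
  case False
  obtain g h where gh: "g \<in> PP1 a" "h \<in> PP1 b" "Some a \<cdot> g = g \<cdot> Some b" "Some b \<cdot> h = h \<cdot> Some a"
    using ab by (rule sim_cE)
  obtain g' h' where gh': "g' \<in> PP1 b" "h' \<in> PP1 c"
    "Some b \<cdot> g' = g' \<cdot> Some c" "Some c \<cdot> h' = h' \<cdot> Some b"
    using bc by (rule sim_cE)
  show ?thesis
  proof (rule sim_cI)
    show "g \<cdot> g' \<in> PP1 a" "h' \<cdot> h \<in> PP1 c"
      using False gh gh' PP1_mult by blast+
  qed (use gh gh' mult1_intertwine in blast)+
qed

lemma equiv_sim_c: "equiv UNIV sim_c"
proof (rule equivI)
  show "refl sim_c"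
    by (rule reflI) (rule sim_c_refl)
  show "sym sim_c"
    by (rule symI) (rule sim_c_sym)
  show "trans sim_c"
    by (rule transI) (rule sim_c_trans)
qed simp

section \<open>Inclusions between the relations\<close>

lemma sim_c_subset_sim_o: "sim_c \<subseteq> sim_o"
  using PP1_subset_S1 by (fastforce simp: sim_c_def sim_o_def)

lemma sim_o_subset_sim_l: "sim_o \<subseteq> sim_l"
  by (auto simp: sim_o_def sim_l_def)

lemma sim_c_eq_sim_o:
  "\<not> (\<exists>z::'a::semigroup_mult. is_zero z) \<Longrightarrow> (sim_c :: 'a rel) = sim_o"
  by (simp add: sim_c_def sim_o_def PP1_no_zero)

text \<open>For a = uv and b = vu, the factors themselves are the witnesses: au = uvu = ub and bv =
  vuv = va.\<close>

lemma sim_p_subset_sim_o: "sim_p \<subseteq> sim_o"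
proof (clarify)
  fix a b :: 'a
  assume "(a, b) \<in> sim_p"
  then obtain u v where uv: "u \<in> S1" "v \<in> S1" "Some a = u \<cdot> v" "Some b = v \<cdot> u"
    by (auto simp: sim_p_def)
  then have "Some a \<cdot> u = u \<cdot> Some b" "Some b \<cdot> v = v \<cdot> Some a"
    by (simp_all only: mult1_assoc)
  with uv show "(a, b) \<in> sim_o"
    by (auto simp: sim_o_def)
qed

section \<open>Groups\<close>

lemma group_sim_l_subset_sim_p:
  assumes "group (*) (e::'a::semigroup_mult) i"
  shows "(sim_l :: 'a rel) \<subseteq> sim_p"
proof (clarify)
  interpret group "(*)" e i
    by (rule assms)
  fix a b :: 'a
  assume "(a, b) \<in> sim_l"
  then obtain g where g: "g \<in> S1" "Some a \<cdot> g = g \<cdot> Some b"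
    by (auto simp: sim_l_def)
  have "\<exists>u v. a = u * v \<and> b = v * u"
  proof (cases g)
    case None
    \<comment> \<open>Here the equation says a = b, and a and e serve as the two factors.\<close>
    with g show ?thesis
      by (metis left_neutral right_neutral mult1.simps(1) mult1_None_right option.inject)
  next
    case (Some x)
    with g have ax: "a * x = x * b"
      by simp
    \<comment> \<open>Solving ax = xb for a and for b exhibits the factors u = xb and v =
      \<open>i x\<close>.\<close>
    have "a = (x * b) * i x"
      by (simp flip: ax add: mult.assoc)
    moreover have "b = i x * (x * b)"
      by (simp flip: mult.assoc)
    ultimately show ?thesis
      by blast
  qed
  then show "(a, b) \<in> sim_p"
    unfolding sim_p_def using Some_in_S1 mult1.simps(3)
    by (metis (mono_tags, lifting) case_prodI mem_Collect_eq)
qed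

text \<open>A group with a zero is trivial, and there reflexivity makes \<open>sim_c\<close> the
  full relation. Every other group falls under the case without zero.\<close>

lemma group_sim_c_eq_sim_o:
  assumes "group (*) (e::'a::semigroup_mult) i"
  shows "(sim_c :: 'a rel) = sim_o"
proof (cases "\<exists>z::'a. is_zero z")
  case True
  interpret group "(*)" e i
    by (rule assms)
  obtain z :: 'a where "is_zero z"
    using True ..
  then have "x = e" for x
    by (metis is_zero_def left_inverse left_neutral)
  then have "x = y" for x y :: 'a
    by metis
  then have "(sim_c :: 'a rel) = UNIV"
    using sim_c_refl by (metis UNIV_eq_I surj_pair)
  with sim_c_subset_sim_o show ?thesis
    by blast
qed (rule sim_c_eq_sim_o)

section \<open>Conjugate words and free semigroups\<close>

lemma append_conjugate:
  assumes "a @ g = g @ b" "a \<noteq> []"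
  shows "\<exists>u v. a = u @ v \<and> b = v @ u"
  using assms
proof (induction g rule: length_induct)
  case (1 g)
  \<comment> \<open>Both a and g are prefixes of the same word, so one is a prefix of the other. If
    g is a prefix of a, then u = g; otherwise one copy of a is cancelled, which shortens g because a
    is nonempty.\<close>
  from "1.prems"(1) consider v where "a = g @ v" "v @ g = b" | g' where "g = a @ g'"
    by (auto simp: append_eq_append_conv2)
  then show ?case
  proof cases
    case 1
    then show ?thesis
      by blast
  next
    case 2
    then have "a @ g' = g' @ b" "length g' < length g"
      using "1.prems" by auto
    then show ?thesis
      using "1.IH" \<open>a \<noteq> []\<close> by blast
  qed
qed

context
  fixes A :: "'a::semigroup_mult set" and \<phi> :: "'a list \<Rightarrow> 'a"
  assumes bij: "bij_betw \<phi> (lists A - {[]}) UNIV"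
    and hom: "\<And>u v. u \<in> lists A - {[]} \<Longrightarrow> v \<in> lists A - {[]} \<Longrightarrow> \<phi> (u @ v) = \<phi> u * \<phi> v"
begin

lemma free_semigroup_word:
  obtains w where "w \<in> lists A" "w \<noteq> []" "\<phi> w = x"
proof -
  have "x \<in> \<phi> ` (lists A - {[]})"
    using bij by (simp add: bij_betw_def)
  then show ?thesis
    using that by blast
qed

lemma free_semigroup_inj:
  "u \<in> lists A - {[]} \<Longrightarrow> v \<in> lists A - {[]} \<Longrightarrow> \<phi> u = \<phi> v \<Longrightarrow> u = v"
  using bij by (auto simp: bij_betw_def inj_on_def)

text \<open>Only the empty word satisfies ww = w. A zero and an identity are both idempotent, so
  this rules out both.\<close>

lemma free_semigroup_no_idempotent: "(x::'a) * x \<noteq> x"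
proof
  assume *: "x * x = x"
  obtain w where w: "w \<in> lists A" "w \<noteq> []" "\<phi> w = x"
    by (rule free_semigroup_word)
  then have "\<phi> (w @ w) = \<phi> w"
    using * hom by auto
  then have "w @ w = w"
    using w free_semigroup_inj[of "w @ w" w] by auto
  with w show False
    by simp
qed

lemma free_semigroup_no_zero: "\<not> is_zero (z::'a)"
  using free_semigroup_no_idempotent by (auto simp: is_zero_def)

lemma free_semigroup_S1: "(S1 :: 'a option set) = UNIV"
proof -
  have "\<not> monoid (*) e" for e :: 'a
    using free_semigroup_no_idempotent monoid.left_neutral by metis
  then show ?thesis
    by (simp add: S1_def)
qed

text \<open>The extension of \<phi> to the free monoid on A. The next three lemmas make it an
  isomorphism onto the options with their product, which are all of \<open>S1\<close> by
  \<open>free_semigroup_S1\<close>.\<close>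

definition word1 :: "'a list \<Rightarrow> 'a option" where
  "word1 w = (if w = [] then None else Some (\<phi> w))"

lemma word1_append: "u \<in> lists A \<Longrightarrow> v \<in> lists A \<Longrightarrow> word1 (u @ v) = word1 u \<cdot> word1 v"
  by (auto simp: word1_def hom)

lemma word1_inj: "u \<in> lists A \<Longrightarrow> v \<in> lists A \<Longrightarrow> word1 u = word1 v \<Longrightarrow> u = v"
  using free_semigroup_inj[of u v] by (auto simp: word1_def split: if_splits)

lemma word1_surj:
  obtains w where "w \<in> lists A" "word1 w = x"
proof (cases x)
  case None
  then show ?thesis
    using that[of "[]"] by (simp add: word1_def)
next
  case (Some y)
  then show ?thesis
    using that free_semigroup_word[of y] by (metis word1_def)
qed

lemma free_semigroup_sim_l_subset_sim_p: "(sim_l :: 'a rel) \<subseteq> sim_p"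
proof (clarify)
  fix a b :: 'a
  assume "(a, b) \<in> sim_l"
  then obtain g where g: "Some a \<cdot> g = g \<cdot> Some b"
    by (auto simp: sim_l_def)
  obtain wa wb wg where w: "wa \<in> lists A" "wb \<in> lists A" "wg \<in> lists A"
    and eqs: "word1 wa = Some a" "word1 wb = Some b" "word1 wg = g"
    by (metis word1_surj)
  have "word1 (wa @ wg) = word1 (wg @ wb)"
    using g w eqs by (simp add: word1_append)
  then have "wa @ wg = wg @ wb"
    using w by (auto intro!: word1_inj)
  moreover have "wa \<noteq> []"
    using eqs by (auto simp: word1_def)
  ultimately obtain u v where uv: "wa = u @ v" "wb = v @ u"
    using append_conjugate by blast
  \<comment> \<open>One of u and v may be empty. Its image is then \<open>None\<close>, an
    admissible factor because \<open>S1\<close> is everything here.\<close>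
  then have "Some a = word1 u \<cdot> word1 v" "Some b = word1 v \<cdot> word1 u"
    using w eqs word1_append[of u v] word1_append[of v u] by auto
  then show "(a, b) \<in> sim_p"
    by (auto simp: sim_p_def free_semigroup_S1)
qed

end

theorem theorem2p2:
  shows "equiv UNIV (sim_c :: 'a::semigroup_mult rel) \<and>
    ((sim_c :: 'a rel) \<subseteq> sim_o \<and> (sim_o :: 'a rel) \<subseteq> sim_l) \<and>
    (\<not> (\<exists>z::'a. is_zero z) \<longrightarrow> (sim_c :: 'a rel) = sim_o) \<and>
    ((\<exists>(e::'a) i. group (*) e i) \<or> is_free_semigroup TYPE('a) \<longrightarrow>
       (sim_c :: 'a rel) = sim_l \<and> (sim_l :: 'a rel) = sim_p \<and> (sim_p :: 'a rel) = sim_o)"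
proof (intro conjI[OF equiv_sim_c] conjI[OF conjI[OF sim_c_subset_sim_o sim_o_subset_sim_l]]
    conjI[OF impI[OF sim_c_eq_sim_o]] impI)
  assume "(\<exists>(e::'a) i. group (*) e i) \<or> is_free_semigroup TYPE('a)"
  \<comment> \<open>The inclusion of \<open>sim_l\<close> in \<open>sim_p\<close> closes the chain
    \<open>sim_p \<subseteq> sim_o \<subseteq> sim_l\<close> into a cycle, so with
    \<open>sim_c = sim_o\<close> all four relations agree.\<close>
  then have "(sim_c :: 'a rel) = sim_o \<and> (sim_l :: 'a rel) \<subseteq> sim_p"
  proof
    assume "\<exists>(e::'a) i. group (*) e i"
    then show ?thesis
      using group_sim_c_eq_sim_o group_sim_l_subset_sim_p by blast
  next
    assume "is_free_semigroup TYPE('a)"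
    then obtain A and \<phi> :: "'a list \<Rightarrow> 'a" where bij: "bij_betw \<phi> (lists A - {[]}) UNIV"
      and hom: "\<forall>u\<in>lists A - {[]}. \<forall>v\<in>lists A - {[]}. \<phi> (u @ v) = \<phi> u * \<phi> v"
      unfolding is_free_semigroup_def by blast
    note free = bij bspec[OF bspec[OF hom]]
    have "\<not> (\<exists>z::'a. is_zero z)"
      using free_semigroup_no_zero[OF free] by blast
    with free_semigroup_sim_l_subset_sim_p[OF free] show ?thesis
      by (simp add: sim_c_eq_sim_o)
  qed
  moreover have "(sim_p :: 'a rel) \<subseteq> sim_o" "(sim_o :: 'a rel) \<subseteq> sim_l"
    by (rule sim_p_subset_sim_o sim_o_subset_sim_l)+
  ultimately show "(sim_c :: 'a rel) = sim_l \<and> (sim_l :: 'a rel) = sim_p \<and> (sim_p :: 'a rel) = sim_o"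
    by (metis subset_antisym subset_trans)
qed

end
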